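(* For every positive integer $k$, the graph $G_k$ contains no pancyclic edge.
   Context: Graphs are finite and simple. An $m$-cycle is a cycle of length $m$ (as a subgraph). An edge $e$ of a graph $G$ of order $n\ge 3$ is a pancyclic edge if, for every $m\in\{3,\ldots,n\}$, $e$ lies in an $m$-cycle of $G$. The graph $G_k$: let $Q=\mathbb{F}_2^3$, with elements written as binary triples and addition coordinatewise modulo $2$. Put $P_0=\{100,010\}$, $P_1=\{001,110,101\}$, $P_2=\{011,111\}$; these form a partition of $Q\setminus\{000\}$. For a positive integer $k$, the vertex set of $G_k$ is $Q\times\{0,1,2\}\times\{1,\ldots,k\}$, where the vertex $(x,i,r)$ is written $x_i^{(r)}$; so $G_k$ has order $24k$. The edges are: (i) internal edges: for every $x\in Q$ and $r\in\{1,\ldots,k\}$, the vertices $x_0^{(r)},x_1^{(r)},x_2^{(r)}$ are pairwise adjacent; (ii) external edges: if $x,y\in Q$ are distinct, $r,s\in\{1,\ldots,k\}$, $i\in\{0,1,2\}$ and $x+y\in P_i$, then $x_i^{(r)}$ and $y_i^{(s)}$ are adjacent. There are no other edges. *)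

theory Defs
  imports Main "HOL-Library.Z2" "HOL-Library.Product_Plus"
begin

text \<open>A simple graph is a pair of a vertex set and a set of two-element vertex sets.\<close>

type_synonym 'a ugraph = "'a set \<times> 'a set set"

abbreviation verts :: "'a ugraph \<Rightarrow> 'a set" where
  "verts G \<equiv> fst G"

abbreviation edges :: "'a ugraph \<Rightarrow> 'a set set" where
  "edges G \<equiv> snd G"

definition simple_graph :: "'a ugraph \<Rightarrow> bool" where
  "simple_graph G \<longleftrightarrow> finite (verts G) \<and> (\<forall>e\<in>edges G. e \<subseteq> verts G \<and> card e = 2)"

text \<open>A cycle subgraph is given by listing its vertices in cyclic order, without repeating
  the first vertex at the end.\<close>

definition cycle_edges :: "'a list \<Rightarrow> 'a set set" where
  "cycle_edges c = {{c ! j, c ! (Suc j mod length c)} | j. j < length c}"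

definition is_cycle :: "'a ugraph \<Rightarrow> nat \<Rightarrow> 'a list \<Rightarrow> bool" where
  "is_cycle G m c \<longleftrightarrow>
     3 \<le> m \<and> length c = m \<and> distinct c \<and> set c \<subseteq> verts G \<and> cycle_edges c \<subseteq> edges G"

definition pancyclic_edge :: "'a ugraph \<Rightarrow> 'a set \<Rightarrow> bool" where
  "pancyclic_edge G e \<longleftrightarrow>
     3 \<le> card (verts G) \<and> e \<in> edges G \<and>
     (\<forall>m\<in>{3..card (verts G)}. \<exists>c. is_cycle G m c \<and> e \<in> cycle_edges c)"

text \<open>Addition on triples of bits is coordinatewise addition modulo 2.\<close>

type_synonym Q = "bit \<times> bit \<times> bit"

definition P :: "nat \<Rightarrow> Q set" where
  "P i = (if i = 0 then {(1,0,0), (0,1,0)}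
          else if i = 1 then {(0,0,1), (1,1,0), (1,0,1)}
          else if i = 2 then {(0,1,1), (1,1,1)}
          else {})"

text \<open>The triple \<open>(x, i, r)\<close> stands for the vertex $x_i^{(r)}$.\<close>

type_synonym vertex = "Q \<times> nat \<times> nat"

definition Gk_verts :: "nat \<Rightarrow> vertex set" where
  "Gk_verts k = UNIV \<times> {0, 1, 2} \<times> {1..k}"

definition internal_edges :: "nat \<Rightarrow> vertex set set" where
  "internal_edges k =
     {{(x, i, r), (x, j, r)} | x i j r.
        i \<in> {0, 1, 2} \<and> j \<in> {0, 1, 2} \<and> i \<noteq> j \<and> r \<in> {1..k}}"

definition external_edges :: "nat \<Rightarrow> vertex set set" where
  "external_edges k =
     {{(x, i, r), (y, i, s)} | x y i r s.
        x \<noteq> y \<and> i \<in> {0, 1, 2} \<and> r \<in> {1..k} \<and> s \<in> {1..k} \<and> x + y \<in> P i}"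

definition Gk :: "nat \<Rightarrow> vertex ugraph" where
  "Gk k = (Gk_verts k, internal_edges k \<union> external_edges k)"

lemma UNIV_bit: "(UNIV :: bit set) = {0, 1}"
  by (auto intro: bit.exhaust)

lemma UNIV_Q: "(UNIV :: Q set) = {0, 1} \<times> {0, 1} \<times> {0, 1}"
  by (simp only: UNIV_bit[symmetric] UNIV_Times_UNIV)

lemma P_partition:
  "P 0 \<union> P 1 \<union> P 2 = UNIV - {0}"
  "P 0 \<inter> P 1 = {}" "P 0 \<inter> P 2 = {}" "P 1 \<inter> P 2 = {}"
proof -
  have "x \<in> P 0 \<union> P 1 \<union> P 2 \<longleftrightarrow> x \<noteq> 0" for x :: Q
  proof -
    obtain a b c where "x = (a, b, c)" by (cases x)
    then show ?thesis
      by (cases a; cases b; cases c; simp add: P_def zero_prod_def)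
  qed
  then show "P 0 \<union> P 1 \<union> P 2 = UNIV - {0}" by blast
qed (simp_all add: P_def)

lemma card_Gk_verts: "card (verts (Gk k)) = 24 * k"
  by (simp add: Gk_def Gk_verts_def UNIV_Q card_cartesian_product)

lemma simple_graph_Gk: "simple_graph (Gk k)"
proof -
  have "finite (Gk_verts k)"
    by (simp add: Gk_verts_def UNIV_Q)
  moreover have "e \<subseteq> Gk_verts k \<and> card e = 2" if "e \<in> internal_edges k" for e
  proof -
    from that obtain x i j r where "e = {(x, i, r), (x, j, r)}"
      "i \<in> {0, 1, 2}" "j \<in> {0, 1, 2}" "i \<noteq> j" "r \<in> {1..k}"
      unfolding internal_edges_def by blast
    then show ?thesis by (simp add: Gk_verts_def)
  qed
  moreover have "e \<subseteq> Gk_verts k \<and> card e = 2" if "e \<in> external_edges k" for e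
  proof -
    from that obtain x y i r s where "e = {(x, i, r), (y, i, s)}"
      "x \<noteq> y" "i \<in> {0, 1, 2}" "r \<in> {1..k}" "s \<in> {1..k}"
      unfolding external_edges_def by blast
    then show ?thesis by (simp add: Gk_verts_def)
  qed
  ultimately show ?thesis
    by (auto simp: simple_graph_def Gk_def)
qed

end

theory Submission imports Defs begin

text \<open>
  No edge lies both in a triangle and in a 4-cycle; since the order \<open>24 * k\<close> is at least 4, a
  pancyclic edge would have to. An internal edge changes the level and keeps the \<open>Q\<close>-component, an
  external edge changes the \<open>Q\<close>-component and keeps the level. Going once around a cycle must undo
  every change, so neither kind of edge can occur exactly once.

  A triangle with an external edge therefore has only external edges. They are all of one level \<open>i\<close>,
  and their three differences lie in \<open>P i\<close> although one is the sum of the other two. This is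
  impossible, because each \<open>P i\<close> is sum-free (\<open>P_sum_free\<close>). So all edges of a triangle are internal
  (\<open>triangle_edge_internal\<close>).

  A 4-cycle with an internal edge does not consist of internal edges only, because only three
  vertices can be reached through these; hence it has two internal and two external edges. Two
  consecutive internal edges would lead to a different level, which external edges do not undo.
  So the two kinds alternate, and the two external edges join vertices over the same two elements of
  \<open>Q\<close>, but at different levels. This is impossible, because the sets \<open>P i\<close> are disjoint
  (\<open>P_index_unique\<close>). So all edges of a 4-cycle are external (\<open>quadrilateral_edge_external\<close>).
\<close>

lemma Gk_edgeE:
  assumes "{(x, i, r), (y, j, s)} \<in> edges (Gk k)"
  obtains (internal) "x = y" "i \<noteq> j" "r = s" "i \<in> {0, 1, 2}" "j \<in> {0, 1, 2}"
        | (external) "x \<noteq> y" "i = j" "x + y \<in> P i"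
  using assms
  by (fastforce simp: Gk_def internal_edges_def external_edges_def doubleton_eq_iff add.commute)

lemma P_sum_free: "p \<in> P i \<Longrightarrow> q \<in> P i \<Longrightarrow> p + q \<notin> P i"
  by (auto simp: P_def split: if_splits)

lemma P_index_unique: "p \<in> P i \<Longrightarrow> p \<in> P j \<Longrightarrow> i = j"
  by (auto simp: P_def split: if_splits)

lemma Q_add_cancel_middle: "(x + y) + (y + z) = x + (z :: Q)"
proof -
  have "y + y = 0"
    by (cases y) (simp add: zero_prod_def)
  then show ?thesis
    by (metis add.assoc add_0)
qed

text \<open>Applying the next two lemmas to all rotations of a cycle gives their conclusion for each of its
  edges, so it is stated for the first edge only.\<close>

lemma triangle_edge_internal:
  assumes xy: "{(x, i, r), (y, j, s)} \<in> edges (Gk k)"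
      and yz: "{(y, j, s), (z, l, t)} \<in> edges (Gk k)"
      and zx: "{(z, l, t), (x, i, r)} \<in> edges (Gk k)"
  shows "x = y"
  using xy
proof (cases rule: Gk_edgeE)
  case external
  have "y + z \<in> P i" "x + z \<in> P i"
    using yz zx external by (auto elim!: Gk_edgeE simp: add.commute)
  with P_sum_free[OF \<open>x + y \<in> P i\<close> \<open>y + z \<in> P i\<close>] show ?thesis
    by (simp add: Q_add_cancel_middle)
qed

lemma quadrilateral_edge_external:
  assumes xy: "{(x, i, r), (y, j, s)} \<in> edges (Gk k)"
      and yz: "{(y, j, s), (z, l, t)} \<in> edges (Gk k)"
      and zw: "{(z, l, t), (w, m, u)} \<in> edges (Gk k)"
      and wx: "{(w, m, u), (x, i, r)} \<in> edges (Gk k)"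
      and "distinct [(x, i, r), (y, j, s), (z, l, t), (w, m, u)]"
  shows "x \<noteq> y"
proof
  assume "x = y"
  with xy have ij: "i \<noteq> j" "r = s" "i \<in> {0, 1, 2}" "j \<in> {0, 1, 2}"
    by (auto elim: Gk_edgeE)
  show False
    using yz
  proof (cases rule: Gk_edgeE)
    case y_to_z: internal
    show False
      using zw
    proof (cases rule: Gk_edgeE)
      case internal
      \<comment> \<open>Four distinct vertices with the same \<open>Q\<close>-component and the same copy number would need
        four levels, but there are only three.\<close>
      with wx y_to_z \<open>x = y\<close> ij assms(5) show False
        by (auto elim: Gk_edgeE)
    next
      case external
      with wx y_to_z \<open>x = y\<close> ij assms(5) show False
        by (auto elim: Gk_edgeE)
    qed
  next
    case y_to_z: external
    show False
      using zw
    proof (cases rule: Gk_edgeE)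
      case internal
      \<comment> \<open>This is the alternating case: \<open>x + z\<close> lies in both \<open>P i\<close> and \<open>P j\<close>.\<close>
      with wx y_to_z \<open>x = y\<close> have "x + z \<in> P i" "x + z \<in> P j"
        by (auto elim!: Gk_edgeE simp: add.commute)
      with ij(1) show False
        by (blast dest: P_index_unique)
    next
      case external
      with wx y_to_z \<open>x = y\<close> ij assms(5) show False
        by (auto elim: Gk_edgeE)
    qed
  qed
qed

lemma cycle_edges_image:
  "cycle_edges c = (\<lambda>j. {c ! j, c ! (Suc j mod length c)}) ` {..<length c}"
  by (auto simp: cycle_edges_def)

lemma triangle_through_edgeE:
  assumes "is_cycle G 3 c" "e \<in> cycle_edges c"
  obtains a b d where "e = {a, b}" "{a, b} \<in> edges G" "{b, d} \<in> edges G" "{d, a} \<in> edges G"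
proof -
  from assms(1) obtain a b d where c: "c = [a, b, d]"
    by (auto simp: is_cycle_def numeral_3_eq_3 length_Suc_conv)
  have ce: "cycle_edges c = {{a, b}, {b, d}, {d, a}}"
    by (auto simp: c cycle_edges_image lessThan_Suc)
  with assms have "e \<in> {{a, b}, {b, d}, {d, a}}" "{{a, b}, {b, d}, {d, a}} \<subseteq> edges G"
    by (auto simp: is_cycle_def)
  then show thesis
    using that[of a b d] that[of b d a] that[of d a b] by auto
qed

lemma quadrilateral_through_edgeE:
  assumes "is_cycle G 4 c" "e \<in> cycle_edges c"
  obtains a b d f where "e = {a, b}" "distinct [a, b, d, f]"
    "{a, b} \<in> edges G" "{b, d} \<in> edges G" "{d, f} \<in> edges G" "{f, a} \<in> edges G"
proof -
  from assms(1) obtain a b d f where c: "c = [a, b, d, f]"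
    by (auto simp: is_cycle_def eval_nat_numeral length_Suc_conv)
  have ce: "cycle_edges c = {{a, b}, {b, d}, {d, f}, {f, a}}"
    by (auto simp: c cycle_edges_image lessThan_Suc)
  with assms have "e \<in> {{a, b}, {b, d}, {d, f}, {f, a}}"
      "{{a, b}, {b, d}, {d, f}, {f, a}} \<subseteq> edges G" "distinct [a, b, d, f]"
    by (auto simp: is_cycle_def c)
  then show thesis
    using that[of a b d f] that[of b d f a] that[of d f a b] that[of f a b d] by auto
qed

theorem lemma4:
  fixes k :: nat
  assumes "k \<ge> 1"
  shows "\<not> (\<exists>e. pancyclic_edge (Gk k) e)"
proof
  assume "\<exists>e. pancyclic_edge (Gk k) e"
  then obtain e where e: "pancyclic_edge (Gk k) e" ..
  have "3 \<in> {3..card (verts (Gk k))}" "4 \<in> {3..card (verts (Gk k))}"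
    using assms by (simp_all add: card_Gk_verts)
  with e obtain c c' where "is_cycle (Gk k) 3 c" "e \<in> cycle_edges c"
      "is_cycle (Gk k) 4 c'" "e \<in> cycle_edges c'"
    unfolding pancyclic_edge_def by meson
  then obtain a b d a' b' d' f' where ab: "e = {a, b}" "e = {a', b'}"
    and tri: "{a, b} \<in> edges (Gk k)" "{b, d} \<in> edges (Gk k)" "{d, a} \<in> edges (Gk k)"
    and quad: "{a', b'} \<in> edges (Gk k)" "{b', d'} \<in> edges (Gk k)" "{d', f'} \<in> edges (Gk k)"
      "{f', a'} \<in> edges (Gk k)" "distinct [a', b', d', f']"
    by (elim triangle_through_edgeE quadrilateral_through_edgeE) blast
  have "fst a = fst b"
    using tri triangle_edge_internal by (metis prod.collapse)
  moreover have "fst a' \<noteq> fst b'"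
    using quad quadrilateral_edge_external by (metis prod.collapse)
  ultimately show False
    using ab by (auto simp: doubleton_eq_iff)
qed

end
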